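(* Consider the plant, local observer, encoder, decoder and reconstructor described in the context, where the initial state, input and disturbance satisfy the stated bounds (Assumption on initial state and signals), the gains are obtained from a solution of the stated matrix inequality, the initial quantization region is $\mathcal{S}_Q^0=\mathcal{H}(x_c,\mathbf{1}_n x_b)$, and the quantization parameters $C^k,L^k$ are updated such that $\hat{x}(t)\in\mathcal{S}_Q^{k+1}$ for all $t\in[t_k,t_{k+1})$ and all $k\in\mathbb{Z}_+$. Then there exist $\beta_r\in\mathcal{KL}$ and $\gamma_r\in\mathcal{K}$ such that the state reconstruction error $e_r(t):=x(t)-x_r(t)$ satisfies $$|e_r(t)|\le \beta_r(|e_r(t_k)|,t-t_k)+\gamma_r\left(\max\{|u|_{[t_k,t]},|d|_{[t_k,t]},|\hat{e}|_{[t_k,t]},|e_q|_{[t_k,t]}\}\right)$$ for all $k\in\mathbb{Z}_+$, all $t\in[t_k,t_{k+1})$ and all $e_r(t_k)\in\mathbb{R}^n$, where $\hat{e}(t):=x(t)-\hat{x}(t)$, $e_q(t):=\hat{x}(t)-P_d^k$ for $t\in[t_k,t_{k+1})$, and $|z|_{[t_k,t]}:=\sup_{s\in[t_k,t]}|z(s)|$.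
   Context: Notation: $\mathbb{Z}_+=\{0,1,2,\dots\}$, $\mathcal{I}_n=\{1,\dots,n\}$. For a vector $x\in\mathbb{R}^n$, $|x|:=\max_{i}|x_i|$. $\mathcal{B}(c,l)=\{x\in\mathbb{R}^n:|x-c|\le l\}$ is the hypercube with center $c\in\mathbb{R}^n$ and radius $l\ge 0$; $\mathcal{H}(c,l)=\{x\in\mathbb{R}^n:|x_i-c_i|\le l_i,\ i\in\mathcal{I}_n\}$ for $c\in\mathbb{R}^n$ and $l\in\mathbb{R}^n_{\ge 0}$ is a hyperrectangle. $\mathbf{1}_n$ is the vector of ones. A continuous $\gamma:\mathbb{R}_{\ge0}\to\mathbb{R}_{\ge0}$ is class $\mathcal{K}$ if it is strictly increasing and $\gamma(0)=0$; a continuous $\alpha:\mathbb{R}_{\ge0}\times\mathbb{R}_{\ge0}\to\mathbb{R}_{\ge0}$ is class $\mathcal{KL}$ if $\alpha(\cdot,s)$ is class $\mathcal{K}$ for every $s\ge0$ and, for every $r\ge0$, $\alpha(r,\cdot)$ is non-increasing with $\alpha(r,s)\to0$ as $s\to\infty$. Plant: $\dot{x}=Ax+Bu+Ed$, $y=Hx$, with $x\in\mathbb{R}^n$, $u\in\mathbb{R}^m$, $y\in\mathbb{R}^{n_y}$, disturbance $d\in\mathbb{R}^o$, known real matrices of appropriate dimensions, $(A,H)$ observable. Assumption on initial state and signals: $x(0)\in\mathcal{B}(x_c,x_b)$, and for all $t\ge0$, $Bu(t)\in\mathcal{B}(\mathbf{0}_n,u_b)$ and $Ed(t)\in\mathcal{B}(\mathbf{0}_n,d_b)$,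 where $x_c\in\mathbb{R}^n$ and $x_b,u_b,d_b\ge0$ are known. Local observer: $\dot{\hat{x}}=A\hat{x}+Bu+K(H\hat{x}-y)$, $\hat{x}(0)=x_c$, where $K=P^{-1}Q$ and $P=P^T\succ0$ in $\mathbb{R}^{n\times n}$, $Q\in\mathbb{R}^{n\times n_y}$, $\nu_1>0$, $\nu_2>0$ are assumed to satisfy $$\begin{bmatrix}A^TP+PA+H^TQ^T+QH+\nu_1I_n & P\\ P & -\nu_2I_n\end{bmatrix}\preceq0.$$ Transmission times: $t_k=kT$, $k\in\mathbb{Z}_+$, with $T>0$. Quantizer: $N$ is a positive integer (the quantization level). At time $t_k$ the quantization region is $\mathcal{S}_Q^k=\mathcal{H}(C^k,L^k)$ with centroid $C^k\in\mathbb{R}^n$ and range $L^k\in\mathbb{R}^n_{\ge0}$; initially $C^0=x_c$, $L^0=\mathbf{1}_nx_b$. The encoder sends, componentwise for $i\in\mathcal{I}_n$, $P_{e,i}^k=\left\lfloor(\hat{x}_i(t_k)+L_i^k-C_i^k)\frac{N}{2L_i^k}\right\rfloor$, (index $0$ if $L_i^k=0$), an index in $\{0,\dots,N-1\}$, and the decoder produces the center of the corresponding subregion, $P_{d,i}^k=C_i^k-L_i^k+\frac{L_i^k}{N}(2P_{e,i}^k+1)$; initialization $P_d^0:=x_c$. Reconstructor: for all $k\in\mathbb{Z}_+$, $\dot{x}_r=Ax_r+K_r(Hx_r-HP_d^k)$ for $t\in[t_k,t_{k+1})$, $x_r(t_k)=P_d^k$, with $x_r(0)=x_c$ and $K_r=P^{-1}Q$,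 where $P=P^T\succ0$ and $Q$ are the same matrices that define the local observer gain $K=P^{-1}Q$, i.e. which together with $\nu_1>0$, $\nu_2>0$ satisfy $\begin{bmatrix}A^TP+PA+H^TQ^T+QH+\nu_1I_n & P\\ P & -\nu_2I_n\end{bmatrix}\preceq0$ (so $K_r=K$). *)

theory Defs
  imports "HOL-Analysis.Analysis"
begin

text \<open>The vector norm $|x| = \max_i |x_i|$ is the library's \<^const>\<open>infnorm\<close>.\<close>

definition hypercube :: "real^'n \<Rightarrow> real \<Rightarrow> (real^'n) set" where
  "hypercube c l = {x. infnorm (x - c) \<le> l}"

definition hyperrectangle :: "real^'n \<Rightarrow> real^'n \<Rightarrow> (real^'n) set" where
  "hyperrectangle c l = {x. \<forall>i. \<bar>x $ i - c $ i\<bar> \<le> l $ i}"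

text \<open>Comparison functions on the nonnegative reals are represented by functions on all
  reals of which only the values at nonnegative arguments matter. They are nonnegative there
  because they are increasing and vanish at 0.\<close>

definition class_K :: "(real \<Rightarrow> real) \<Rightarrow> bool" where
  "class_K g \<longleftrightarrow> continuous_on {0..} g \<and> strict_mono_on {0..} g \<and> g 0 = 0"

definition class_KL :: "(real \<Rightarrow> real \<Rightarrow> real) \<Rightarrow> bool" where
  "class_KL b \<longleftrightarrow>
     continuous_on ({0..} \<times> {0..}) (\<lambda>(r, s). b r s) \<and>
     (\<forall>s\<ge>0. class_K (\<lambda>r. b r s)) \<and>
     (\<forall>r\<ge>0. antimono_on {0..} (b r) \<and> (b r \<longlongrightarrow> 0) at_top)"

text \<open>A real supremum, hence meaningful only if \<open>z\<close> is bounded on the interval; this is why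
  inputs and disturbances are required to be \<open>locally_bounded\<close> below (bounds on $Bu$ and $Ed$ alone
  do not bound $u$ and $d$).\<close>

definition sup_norm :: "(real \<Rightarrow> real^'n) \<Rightarrow> real \<Rightarrow> real \<Rightarrow> real" where
  "sup_norm z a b = (SUP s\<in>{a..b}. infnorm (z s))"

definition positive_definite :: "real^'n^'n \<Rightarrow> bool" where
  "positive_definite M \<longleftrightarrow> transpose M = M \<and> (\<forall>v. v \<noteq> 0 \<longrightarrow> v \<bullet> (M *v v) > 0)"

definition negative_semidefinite :: "real^'n^'n \<Rightarrow> bool" where
  "negative_semidefinite M \<longleftrightarrow> transpose M = M \<and> (\<forall>v. v \<bullet> (M *v v) \<le> 0)"

definition block_matrix ::
  "real^'a^'c \<Rightarrow> real^'b^'c \<Rightarrow> real^'a^'d \<Rightarrow> real^'b^'d \<Rightarrow> real^('a + 'b)^('c + 'd)" where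
  "block_matrix M11 M12 M21 M22 =
     (\<chi> i j. case i of
        Inl i' \<Rightarrow> (case j of Inl j' \<Rightarrow> M11 $ i' $ j' | Inr j' \<Rightarrow> M12 $ i' $ j')
      | Inr i' \<Rightarrow> (case j of Inl j' \<Rightarrow> M21 $ i' $ j' | Inr j' \<Rightarrow> M22 $ i' $ j'))"

text \<open>The output of the unforced system on some finite time interval determines the initial
  state.\<close>

definition observable_pair :: "real^'n^'n \<Rightarrow> real^'n^'p \<Rightarrow> bool" where
  "observable_pair A H \<longleftrightarrow>
     (\<exists>\<tau>>0. \<forall>x1 x2.
        (\<forall>t\<in>{0..\<tau>}. (x1 has_vector_derivative A *v x1 t) (at t within {0..\<tau>})) \<and>
        (\<forall>t\<in>{0..\<tau>}. (x2 has_vector_derivative A *v x2 t) (at t within {0..\<tau>})) \<and>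
        (\<forall>t\<in>{0..\<tau>}. H *v x1 t = H *v x2 t) \<longrightarrow>
        x1 0 = x2 0)"

text \<open>Solutions in the sense of Caratheodory, so that inputs and disturbances need not be
  continuous. The differential equation is read as the integral equation
  $x(t) = x(0) + \int_0^t f(s, x(s))\, ds$, whose solvability includes integrability of the
  right-hand side.\<close>

definition solves_ode :: "(real \<Rightarrow> real^'n \<Rightarrow> real^'n) \<Rightarrow> (real \<Rightarrow> real^'n) \<Rightarrow> bool" where
  "solves_ode f x \<longleftrightarrow> (\<forall>t\<ge>0. ((\<lambda>s. f s (x s)) has_integral (x t - x 0)) {0..t})"

definition locally_bounded :: "(real \<Rightarrow> real^'n) \<Rightarrow> bool" where
  "locally_bounded z \<longleftrightarrow> (\<forall>t\<ge>0. bounded (z ` {0..t}))"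

text \<open>Componentwise quantizer on the interval with center \<open>c\<close> and half-width \<open>l\<close>. The minimum
  keeps the index in $\{0,\dots,N-1\}$ when \<open>z\<close> is the right endpoint \<open>c + l\<close>, where the floor
  alone would give \<open>N\<close>. In other words, the last subinterval is closed.\<close>

definition encode :: "nat \<Rightarrow> real \<Rightarrow> real \<Rightarrow> real \<Rightarrow> int" where
  "encode N c l z =
     (if l = 0 then 0 else min (int N - 1) \<lfloor>(z + l - c) * (real N / (2 * l))\<rfloor>)"

definition decode :: "nat \<Rightarrow> real \<Rightarrow> real \<Rightarrow> int \<Rightarrow> real" where
  "decode N c l p = c - l + l / real N * (2 * of_int p + 1)"

definition decoded_state ::
  "nat \<Rightarrow> real \<Rightarrow> real^'n \<Rightarrow> (nat \<Rightarrow> real^'n) \<Rightarrow> (nat \<Rightarrow> real^'n) \<Rightarrow> (real \<Rightarrow> real^'n) \<Rightarrow> nat \<Rightarrow> real^'n" where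
  "decoded_state N T xc C L xhat k =
     (if k = 0 then xc
      else (\<chi> i. decode N (C k $ i) (L k $ i)
                   (encode N (C k $ i) (L k $ i) (xhat (real k * T) $ i))))"

end

theory Submission
  imports Defs
begin

text \<open>The error $e = x - x_r$ satisfies $\dot e = (A + KH) e + w$ on each sampling interval, with
  $w = Bu + Ed - KH(\hat e + e_q)$. The matrix inequality, evaluated at $(e, w)$, says that
  $V = e^T P e$ dissipates: $\dot V \le -\nu_1 \|e\|^2 + \nu_2 \|w\|^2$, whence exponential decay
  up to the size of $w$. Since $e$ is only an indefinite integral, $V$ need not be differentiable;
  the dissipation inequality is therefore used as an estimate of the forward difference quotients
  of $V$, which suffices for the comparison argument.\<close>

section \<open>A scalar comparison principle\<close>

text \<open>Continuous induction against a barrier: raised by \<open>\<eta>\<close>, the right-hand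
  side solves the linear comparison equation with input \<open>c + \<kappa> * \<eta>\<close>, and
  the last point at which \<open>V\<close> lies below it must be \<open>b\<close>. The hypothesis
  \<open>step\<close> stands in for a bound on the upper right derivative, as \<open>V\<close> is
  only continuous.\<close>

lemma comparison_decay:
  fixes V :: "real \<Rightarrow> real"
  assumes "a \<le> b" "\<kappa> > 0" "c \<ge> 0" "V a \<ge> 0" and cont: "continuous_on {a..b} V"
    and step: "\<And>s \<epsilon>. \<lbrakk>a \<le> s; s < b; \<epsilon> > 0\<rbrakk> \<Longrightarrow>
      \<exists>\<delta>>0. \<forall>h. 0 < h \<and> h < \<delta> \<and> s + h \<le> b \<longrightarrow> V (s + h) \<le> V s + h * (c - \<kappa> * V s + \<epsilon>)"
  shows "V b \<le> V a * exp (- \<kappa> * (b - a)) + c / \<kappa>"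
proof (rule field_le_epsilon)
  fix \<eta> :: real assume "\<eta> > 0"
  define \<phi> where "\<phi> s = V a * exp (- \<kappa> * (s - a)) + c / \<kappa> + \<eta>" for s
  define S where "S = {s \<in> {a..b}. V s \<le> \<phi> s}"
  have "closed S"
    unfolding S_def \<phi>_def by (intro continuous_on_closed_Collect_le continuous_intros cont)
  moreover have "a \<in> S"
    using assms \<open>\<eta> > 0\<close> by (simp add: S_def \<phi>_def)
  moreover have "bdd_above S"
    by (auto simp: S_def)
  ultimately have s: "Sup S \<in> S" and above: "\<And>r. r \<in> S \<Longrightarrow> r \<le> Sup S"
    using closed_contains_Sup[of S] cSup_upper[of _ S] by auto
  define s where "s = Sup S"
  have "s = b"
  proof (rule ccontr)
    assume "s \<noteq> b"
    with s have sab: "a \<le> s" "s < b" and Vs: "V s \<le> \<phi> s" by (auto simp: S_def s_def)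
    obtain \<delta> where \<delta>: "\<delta> > 0"
      \<comment> \<open>The slack is taken as \<open>\<kappa> * \<eta>\<close> because the perturbed
        equation then has the equilibrium \<open>c / \<kappa> + \<eta>\<close>, the constant part of
        \<open>\<phi>\<close>.\<close>
      "\<And>h. 0 < h \<Longrightarrow> h < \<delta> \<Longrightarrow> s + h \<le> b \<Longrightarrow> V (s + h) \<le> V s + h * (c - \<kappa> * V s + \<kappa> * \<eta>)"
      using step[OF sab, of "\<kappa> * \<eta>"] \<open>\<eta> > 0\<close> \<open>\<kappa> > 0\<close> by auto
    \<comment> \<open>The bound \<open>1 / \<kappa>\<close> keeps \<open>1 - \<kappa> * h\<close>
      nonnegative, so that \<open>V s\<close> may be replaced by the larger \<open>\<phi> s\<close>
      after multiplication.\<close>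
    define h where "h = min (\<delta> / 2) (min (b - s) (1 / \<kappa>))"
    have h: "0 < h" "h < \<delta>" "s + h \<le> b" "h \<le> 1 / \<kappa>"
      using \<delta>(1) sab \<open>\<kappa> > 0\<close> by (auto simp: h_def)
    then have "\<kappa> * h \<le> 1" using \<open>\<kappa> > 0\<close> by (simp add: field_simps)
    have "V (s + h) \<le> V s * (1 - \<kappa> * h) + h * (c + \<kappa> * \<eta>)"
      using \<delta>(2)[OF h(1-3)] by (simp add: algebra_simps)
    also have "\<dots> \<le> \<phi> s * (1 - \<kappa> * h) + h * (c + \<kappa> * \<eta>)"
      using Vs \<open>\<kappa> * h \<le> 1\<close> by (simp add: mult_right_mono)
    also have "\<dots> = V a * exp (- \<kappa> * (s - a)) * (1 + (- \<kappa> * h)) + c / \<kappa> + \<eta>"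
      using \<open>\<kappa> > 0\<close> by (simp add: \<phi>_def field_simps)
    \<comment> \<open>An Euler step of the decaying exponential stays below the exact solution:
      \<open>1 + y \<le> exp y\<close>.\<close>
    also have "\<dots> \<le> V a * exp (- \<kappa> * (s - a)) * exp (- \<kappa> * h) + c / \<kappa> + \<eta>"
      using \<open>V a \<ge> 0\<close> exp_ge_add_one_self[of "- \<kappa> * h"] by (intro add_mono mult_left_mono) auto
    also have "\<dots> = \<phi> (s + h)"
      by (simp add: \<phi>_def mult.assoc exp_add [symmetric] algebra_simps)
    finally have "s + h \<in> S" using h sab by (simp add: S_def)
    then show False using above[of "s + h"] h(1) by (simp add: s_def)
  qed
  then show "V b \<le> V a * exp (- \<kappa> * (b - a)) + c / \<kappa> + \<eta>"
    using s by (simp add: S_def s_def \<phi>_def)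
qed

section \<open>Estimates for matrices and quadratic forms\<close>

lemma matrix_norm_bound:
  fixes M :: "real^'a^'b"
  obtains c where "c > 0" "\<And>v. norm (M *v v) \<le> c * norm v"
  using bounded_linear.pos_bounded[OF matrix_vector_mul_bounded_linear[of M]] by (metis mult.commute)

text \<open>The form attains its minimum on the compact unit sphere; that minimum is positive and
  serves as \<open>p\<close>. Homogeneity of degree two carries the bound to all vectors.\<close>

lemma positive_definite_coercive:
  fixes P :: "real^'n^'n"
  assumes "positive_definite P"
  obtains p where "p > 0" "\<And>v. p * (norm v)\<^sup>2 \<le> v \<bullet> (P *v v)"
proof -
  have "compact (sphere 0 1 :: (real^'n) set)" "(sphere 0 1 :: (real^'n) set) \<noteq> {}"
    by auto
  moreover have "continuous_on (sphere 0 1) (\<lambda>v. v \<bullet> (P *v v))"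
    by (intro continuous_intros linear_continuous_on) auto
  ultimately obtain w where w: "norm w = 1"
    and min: "\<And>v. norm v = 1 \<Longrightarrow> w \<bullet> (P *v w) \<le> v \<bullet> (P *v v)"
    using continuous_attains_inf[of "sphere 0 1" "\<lambda>v. v \<bullet> (P *v v)"] by auto
  show ?thesis
  proof
    show "w \<bullet> (P *v w) > 0"
      using assms w by (metis norm_zero positive_definite_def zero_neq_one)
    show "w \<bullet> (P *v w) * (norm v)\<^sup>2 \<le> v \<bullet> (P *v v)" for v
    proof (cases "v = 0")
      case False
      have "w \<bullet> (P *v w) \<le> (v /\<^sub>R norm v) \<bullet> (P *v (v /\<^sub>R norm v))"
        using False by (intro min) simp
      also have "\<dots> = v \<bullet> (P *v v) / (norm v)\<^sup>2"
        by (simp add: matrix_vector_mult_scaleR power2_eq_square field_simps)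
      finally show ?thesis using False by (simp add: field_simps)
    qed simp
  qed
qed

lemma dot_matrix_vector_mult:
  fixes M :: "real^'a^'b"
  shows "v \<bullet> (M *v w) = (transpose M *v v) \<bullet> w"
  by (simp add: dot_lmul_matrix)

text \<open>Expansion of the quadratic form along one Euler step of length \<open>h\<close>:
  symmetry of \<open>P\<close> merges the two cross terms, which the dissipation inequality bounds,
  and Cauchy-Schwarz bounds the remainder of order two in \<open>h\<close>.\<close>

lemma lyapunov_quadratic_step:
  fixes P F :: "real^'n^'n"
  assumes sym: "transpose P = P"
    and diss: "\<And>v z. 2 * (v \<bullet> (P *v (F *v v + z))) \<le> - \<nu>1 * (norm v)\<^sup>2 + \<nu>2 * (norm z)\<^sup>2"
    and "\<And>v. norm (P *v v) \<le> p * norm v"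
    and "h \<ge> 0"
  shows "(v + h *\<^sub>R (F *v v + z)) \<bullet> (P *v (v + h *\<^sub>R (F *v v + z)))
       \<le> v \<bullet> (P *v v) + h * (- \<nu>1 * (norm v)\<^sup>2 + \<nu>2 * (norm z)\<^sup>2) + h\<^sup>2 * (p * (norm (F *v v + z))\<^sup>2)"
proof -
  define y where "y = F *v v + z"
  have "y \<bullet> (P *v y) \<le> norm y * (p * norm y)"
    using norm_cauchy_schwarz[of y "P *v y"] mult_left_mono[OF assms(3), of "norm y" y] by auto
  then have y: "y \<bullet> (P *v y) \<le> p * (norm y)\<^sup>2"
    by (simp add: power2_eq_square mult_ac)
  have "(v + h *\<^sub>R y) \<bullet> (P *v (v + h *\<^sub>R y))
      = v \<bullet> (P *v v) + h * (2 * (v \<bullet> (P *v y))) + h\<^sup>2 * (y \<bullet> (P *v y))"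
    using dot_matrix_vector_mult[of y P v] sym
    by (simp add: matrix_vector_mult_scaleR matrix_vector_right_distrib inner_add inner_commute
        power2_eq_square algebra_simps)
  also have "\<dots> \<le> v \<bullet> (P *v v) + h * (- \<nu>1 * (norm v)\<^sup>2 + \<nu>2 * (norm z)\<^sup>2) + h\<^sup>2 * (p * (norm y)\<^sup>2)"
    unfolding y_def using \<open>h \<ge> 0\<close> y[unfolded y_def] by (intro add_mono mult_left_mono diss) auto
  finally show ?thesis unfolding y_def .
qed

section \<open>Integral equations on subintervals\<close>

lemma integral_equation_subinterval:
  fixes g :: "real \<Rightarrow> 'a::euclidean_space"
  assumes "\<And>t. t \<in> {a..b} \<Longrightarrow> (g has_integral (e t - e a)) {a..t}" "a \<le> s" "s \<le> t" "t \<le> b"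
  shows "(g has_integral (e t - e s)) {s..t}"
proof -
  have at: "(g has_integral (e t - e a)) {a..t}" and as: "(g has_integral (e s - e a)) {a..s}"
    using assms by auto
  have "g integrable_on {s..t}"
    using has_integral_integrable[OF at] by (rule integrable_subinterval_real) (use assms in auto)
  moreover have "integral {s..t} g = e t - e s"
    using Henstock_Kurzweil_Integration.integral_combine[of a s t g] at as assms
    by (auto simp: integral_unique has_integral_integrable algebra_simps)
  ultimately show ?thesis by (metis integrable_integral)
qed

lemma integral_equation_continuous:
  fixes g :: "real \<Rightarrow> 'a::euclidean_space"
  assumes "\<And>t. t \<in> {a..b} \<Longrightarrow> (g has_integral (e t - e a)) {a..t}"
  shows "continuous_on {a..b} e"
proof (cases "a \<le> b")
  case True
  then have "g integrable_on {a..b}" using assms[of b] by auto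
  then have "continuous_on {a..b} (\<lambda>t. e a + integral {a..t} g)"
    by (intro continuous_intros indefinite_integral_continuous_1)
  moreover have "e a + integral {a..t} g = e t" if "t \<in> {a..b}" for t
    using integral_unique[OF assms[OF that]] by simp
  ultimately show ?thesis by (rule continuous_on_eq)
qed simp

text \<open>Rows and columns are indexed by a sum type, so each sum splits into its
  \<open>Inl\<close> and \<open>Inr\<close> parts; \<open>v x y\<close> is the stacked
  vector.\<close>

lemma block_matrix_quadratic_form:
  fixes M11 :: "real^'a^'a" and M12 :: "real^'b^'a" and M21 :: "real^'a^'b" and M22 :: "real^'b^'b"
  defines "v \<equiv> (\<lambda>x y. (\<chi> i. case i of Inl i' \<Rightarrow> x $ i' | Inr i' \<Rightarrow> y $ i'))"
  shows "v x y \<bullet> (block_matrix M11 M12 M21 M22 *v v x y)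
    = x \<bullet> (M11 *v x + M12 *v y) + y \<bullet> (M21 *v x + M22 *v y)"
proof -
  have sum_split: "(\<Sum>i\<in>UNIV. f i) = (\<Sum>i\<in>UNIV. f (Inl i)) + (\<Sum>i\<in>UNIV. f (Inr i))"
    for f :: "'a + 'b \<Rightarrow> real"
    by (simp add: UNIV_Plus_UNIV[symmetric] sum.Plus del: UNIV_Plus_UNIV)
  show ?thesis
    by (simp add: v_def inner_vec_def matrix_vector_mult_def block_matrix_def sum_split)
qed

section \<open>Exponential decay up to the size of the input\<close>

text \<open>The comparison principle is applied to the quadratic form of \<open>P\<close> along
  \<open>e\<close>. The constants come from \<open>P\<close>, \<open>F\<close>,
  \<open>\<nu>1\<close> and \<open>\<nu>2\<close> only and precede the interval, the trajectory and
  the input; this is what makes the final gains uniform over all sampling intervals.\<close>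

lemma lyapunov_input_bound:
  fixes P F :: "real^'n^'n"
  assumes P: "positive_definite P" and \<nu>: "\<nu>1 > 0" "\<nu>2 > 0"
    and diss: "\<And>v z. 2 * (v \<bullet> (P *v (F *v v + z))) \<le> - \<nu>1 * (norm v)\<^sup>2 + \<nu>2 * (norm z)\<^sup>2"
  obtains c1 c2 \<mu> where "c1 > 0" "c2 > 0" "\<mu> > 0"
    "\<And>a b e w W. \<lbrakk>a \<le> b; \<And>t. t \<in> {a..b} \<Longrightarrow> ((\<lambda>s. F *v e s + w s) has_integral (e t - e a)) {a..t};
       \<And>s. s \<in> {a..b} \<Longrightarrow> norm (w s) \<le> W\<rbrakk>
       \<Longrightarrow> norm (e b) \<le> c1 * norm (e a) * exp (- \<mu> * (b - a)) + c2 * W"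
proof -
  obtain p0 where p0: "p0 > 0" "\<And>v. p0 * (norm v)\<^sup>2 \<le> v \<bullet> (P *v v)"
    using positive_definite_coercive[OF P] by blast
  obtain p where p: "p > 0" "\<And>v. norm (P *v v) \<le> p * norm v"
    using matrix_norm_bound[of P] by blast
  obtain f where f: "f > 0" "\<And>v. norm (F *v v) \<le> f * norm v"
    using matrix_norm_bound[of F] by blast
  \<comment> \<open>With \<open>V \<le> p * (norm e)\<^sup>2\<close>, the dissipation
    \<open>- \<nu>1 * (norm e)\<^sup>2\<close> is at most \<open>- \<kappa> * V\<close>.\<close>
  define \<kappa> where "\<kappa> = \<nu>1 / p"
  have "\<kappa> > 0" using p \<nu> by (simp add: \<kappa>_def)
  have V_le: "v \<bullet> (P *v v) \<le> p * (norm v)\<^sup>2" for v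
    using norm_cauchy_schwarz[of v "P *v v"] mult_left_mono[OF p(2), of "norm v" v]
    by (simp add: power2_eq_square mult_ac)
  have bound: "norm (e b) \<le> sqrt (p / p0) * norm (e a) * exp (- (\<kappa> / 2) * (b - a)) + sqrt (\<nu>2 / (\<kappa> * p0)) * W"
    if ab: "a \<le> b"
      and int: "\<And>t. t \<in> {a..b} \<Longrightarrow> ((\<lambda>s. F *v e s + w s) has_integral (e t - e a)) {a..t}"
      and W: "\<And>s. s \<in> {a..b} \<Longrightarrow> norm (w s) \<le> W"
    for a b e w W
  proof -
    define V where "V s = e s \<bullet> (P *v e s)" for s
    have "W \<ge> 0" using order_trans[OF norm_ge_zero W[of a]] ab by simp
    have cont: "continuous_on {a..b} e"
      using int by (rule integral_equation_continuous)
    have "V b \<le> V a * exp (- \<kappa> * (b - a)) + \<nu>2 * W\<^sup>2 / \<kappa>"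
    proof (rule comparison_decay)
      show "0 \<le> V a" 
        unfolding V_def by (rule order_trans[OF _ p0(2)]) (use p0(1) in simp)
      show "continuous_on {a..b} V"
        unfolding V_def using cont
        by (intro continuous_intros bounded_linear.continuous_on[OF matrix_vector_mul_bounded_linear])
    next
      fix s \<epsilon> :: real assume s: "a \<le> s" "s < b" and "\<epsilon> > 0"
      \<comment> \<open>As \<open>\<eta> \<le> 1\<close>, replacing \<open>W\<close> by
        \<open>W + \<eta>\<close> raises \<open>\<nu>2 * W\<^sup>2\<close> by at most
        \<open>\<nu>2 * \<eta> * (2 * W + 1)\<close>, hence by at most half of
        \<open>\<epsilon>\<close>. The number \<open>R\<close> will bound the mean velocity of
        \<open>e\<close> over a short step.\<close>
      define \<eta> where "\<eta> = min 1 (\<epsilon> / (2 * \<nu>2 * (2 * W + 1)))"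
      define R where "R = f * norm (e s) + W + 1"
      have "\<eta> > 0" "\<eta> \<le> 1" using \<open>\<epsilon> > 0\<close> \<open>W \<ge> 0\<close> \<nu> by (auto simp: \<eta>_def)
      have "\<eta> * (2 * \<nu>2 * (2 * W + 1)) \<le> \<epsilon>"
        using \<nu> \<open>W \<ge> 0\<close> by (subst pos_le_divide_eq[symmetric]) (auto simp: \<eta>_def)
      moreover have "\<nu>2 * \<eta>\<^sup>2 \<le> \<nu>2 * \<eta>"
        using \<open>\<eta> > 0\<close> \<open>\<eta> \<le> 1\<close> \<nu> by (simp add: power2_eq_square)
      ultimately have \<eta>: "\<nu>2 * (W + \<eta>)\<^sup>2 \<le> \<nu>2 * W\<^sup>2 + \<epsilon> / 2"
        by (simp add: power2_eq_square algebra_simps)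
      have "R > 0" using f \<open>W \<ge> 0\<close> by (simp add: R_def add_nonneg_pos)
      have "s \<in> {a..b}" "\<eta> / f > 0" using s \<open>\<eta> > 0\<close> f(1) by auto
      \<comment> \<open>The tolerance \<open>\<eta> / f\<close> is chosen so that \<open>F\<close>
        maps the variation of \<open>e\<close> over the step to a vector of norm at most
        \<open>\<eta>\<close>.\<close>
      with cont obtain \<delta> where \<delta>: "\<delta> > 0"
        "\<And>r. r \<in> {a..b} \<Longrightarrow> dist r s < \<delta> \<Longrightarrow> dist (e r) (e s) < \<eta> / f"
        unfolding continuous_on_iff by blast
      show "\<exists>\<delta>>0. \<forall>h. 0 < h \<and> h < \<delta> \<and> s + h \<le> b \<longrightarrow> V (s + h) \<le> V s + h * (\<nu>2 * W\<^sup>2 - \<kappa> * V s + \<epsilon>)"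
      \<comment> \<open>The second bound on \<open>h\<close> limits the quadratic remainder to
        \<open>h * (\<epsilon> / 2)\<close>, the other half of the slack.\<close>
      proof (intro exI[of _ "min \<delta> (\<epsilon> / (2 * p * R\<^sup>2))"] conjI allI impI)
        show "0 < min \<delta> (\<epsilon> / (2 * p * R\<^sup>2))" using \<delta> \<open>\<epsilon> > 0\<close> p \<open>R > 0\<close> by simp
        fix h assume "0 < h \<and> h < min \<delta> (\<epsilon> / (2 * p * R\<^sup>2)) \<and> s + h \<le> b"
        then have h: "0 < h" "h < \<delta>" "s + h \<le> b" and "h < \<epsilon> / (2 * p * R\<^sup>2)" by auto
        then have hR: "h * (p * R\<^sup>2) \<le> \<epsilon> / 2"
          using p \<open>R > 0\<close> by (simp add: field_simps)
        \<comment> \<open>\<open>z\<close> is the mean over the step of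
          \<open>w r + F *v (e r - e s)\<close>. With it the increment of \<open>e\<close> is
          exactly an Euler step with the state frozen at \<open>e s\<close>, although
          \<open>w\<close> need not be continuous.\<close>
        define z where "z = (e (s + h) - e s - h *\<^sub>R (F *v e s)) /\<^sub>R h"
        have "((\<lambda>r. F *v e r + w r) has_integral (e (s + h) - e s)) {s..s + h}"
          by (rule integral_equation_subinterval[OF int]) (use s h in auto)
        from has_integral_diff[OF this has_integral_const_real[of "F *v e s" s "s + h"]] h
        have incr: "((\<lambda>r. F *v e r + w r - F *v e s) has_integral (e (s + h) - e s - h *\<^sub>R (F *v e s))) {s..s + h}"
          by simp
        have "norm (F *v e r + w r - F *v e s) \<le> W + \<eta>" if "r \<in> {s..s + h}" for r
        proof -
          have "norm (F *v (e r - e s)) \<le> f * (\<eta> / f)"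
            using \<delta>(2)[of r] that h s f
            by (intro order_trans[OF f(2)] mult_left_mono) (auto simp: dist_norm)
          moreover have "norm (w r) \<le> W" using W[of r] that h s by auto
          ultimately show ?thesis
            using norm_triangle_ineq[of "F *v (e r - e s)" "w r"] f
            by (simp add: matrix_vector_mult_diff_distrib algebra_simps)
        qed
        then have "norm (e (s + h) - e s - h *\<^sub>R (F *v e s)) \<le> (W + \<eta>) * measure lborel {s..s + h}"
          using \<open>W \<ge> 0\<close> \<open>\<eta> > 0\<close> by (intro has_integral_bound_real[OF _ finite.emptyI incr]) auto
        moreover have "norm z = norm (e (s + h) - e s - h *\<^sub>R (F *v e s)) / h"
          using h by (simp add: z_def divide_inverse mult.commute)
        ultimately have z: "norm z \<le> W + \<eta>"
          using h by (simp add: pos_divide_le_eq)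
        have e: "e (s + h) = e s + h *\<^sub>R (F *v e s + z)"
          using h by (simp add: z_def algebra_simps)
        have "norm (F *v e s + z) \<le> R"
          using norm_triangle_ineq[of "F *v e s" z] f(2)[of "e s"] z \<open>\<eta> \<le> 1\<close> by (simp add: R_def)
        then have "h * (p * (norm (F *v e s + z))\<^sup>2) \<le> h * (p * R\<^sup>2)"
          using h p by (intro mult_left_mono power_mono) auto
        from mult_left_mono[OF order_trans[OF this hR], of h] h
        have "h * (h * (p * (norm (F *v e s + z))\<^sup>2)) \<le> h * (\<epsilon> / 2)"
          by simp
        then have quad: "h\<^sup>2 * (p * (norm (F *v e s + z))\<^sup>2) \<le> h * (\<epsilon> / 2)"
          by (simp only: power2_eq_square mult.assoc)
        have "\<nu>2 * (norm z)\<^sup>2 \<le> \<nu>2 * (W + \<eta>)\<^sup>2"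
          using z \<nu> by (intro mult_left_mono power_mono) auto
        moreover have "- \<nu>1 * (norm (e s))\<^sup>2 \<le> - \<kappa> * V s"
          using mult_left_mono[OF V_le, of \<kappa> "e s"] \<open>\<kappa> > 0\<close> p by (simp add: V_def \<kappa>_def)
        ultimately have "- \<nu>1 * (norm (e s))\<^sup>2 + \<nu>2 * (norm z)\<^sup>2 \<le> - \<kappa> * V s + \<nu>2 * W\<^sup>2 + \<epsilon> / 2"
          using \<eta> by simp
        then have lin: "h * (- \<nu>1 * (norm (e s))\<^sup>2 + \<nu>2 * (norm z)\<^sup>2) \<le> h * (- \<kappa> * V s + \<nu>2 * W\<^sup>2 + \<epsilon> / 2)"
          using h by (intro mult_left_mono) auto
        have "V (s + h) \<le> V s + h * (- \<nu>1 * (norm (e s))\<^sup>2 + \<nu>2 * (norm z)\<^sup>2)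
            + h\<^sup>2 * (p * (norm (F *v e s + z))\<^sup>2)"
          unfolding V_def e using P diss p(2) h
          by (intro lyapunov_quadratic_step) (auto simp: positive_definite_def)
        also have "\<dots> \<le> V s + h * (- \<kappa> * V s + \<nu>2 * W\<^sup>2 + \<epsilon> / 2) + h * (\<epsilon> / 2)"
          using lin quad by linarith
        also have "\<dots> = V s + h * (\<nu>2 * W\<^sup>2 - \<kappa> * V s + \<epsilon>)" by (simp add: algebra_simps)
        finally show "V (s + h) \<le> V s + h * (\<nu>2 * W\<^sup>2 - \<kappa> * V s + \<epsilon>)" .
      qed
    qed (use ab \<open>\<kappa> > 0\<close> \<nu> in auto)
    then have "p0 * (norm (e b))\<^sup>2 \<le> p * (norm (e a))\<^sup>2 * exp (- \<kappa> * (b - a)) + \<nu>2 * W\<^sup>2 / \<kappa>"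
      using p0(2)[of "e b"] mult_right_mono[OF V_le[of "e a"] exp_ge_zero[of "- \<kappa> * (b - a)"]]
      unfolding V_def by linarith
    then have "(norm (e b))\<^sup>2 \<le> p / p0 * (norm (e a))\<^sup>2 * exp (- \<kappa> * (b - a)) + \<nu>2 / (\<kappa> * p0) * W\<^sup>2"
      using p0(1) \<open>\<kappa> > 0\<close> by (simp add: field_simps)
    then have "norm (e b) \<le> sqrt (p / p0 * (norm (e a))\<^sup>2 * exp (- \<kappa> * (b - a)) + \<nu>2 / (\<kappa> * p0) * W\<^sup>2)"
      by (rule real_le_rsqrt)
    \<comment> \<open>Subadditivity of the square root separates the decaying term from the input
      term.\<close>
    also have "\<dots> \<le> sqrt (p / p0 * (norm (e a))\<^sup>2 * exp (- \<kappa> * (b - a))) + sqrt (\<nu>2 / (\<kappa> * p0) * W\<^sup>2)"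
      using p p0 \<nu> \<open>\<kappa> > 0\<close> by (intro sqrt_add_le_add_sqrt) auto
    \<comment> \<open>Passing from \<open>V\<close> to the norm halves the decay rate.\<close>
    also have "exp (- \<kappa> * (b - a)) = (exp (- (\<kappa> / 2) * (b - a)))\<^sup>2"
      by (simp flip: exp_double)
    finally show ?thesis
      by (simp only: real_sqrt_mult real_sqrt_abs abs_norm_cancel abs_exp_cancel abs_of_nonneg[OF \<open>W \<ge> 0\<close>])
  qed
  show ?thesis
    using p p0 \<nu> \<open>\<kappa> > 0\<close>
    by (intro that[of "sqrt (p / p0)" "sqrt (\<nu>2 / (\<kappa> * p0))" "\<kappa> / 2"] bound) auto
qed

section \<open>From the matrix inequality to dissipation\<close>

text \<open>The block form is evaluated at the stacked vector of \<open>v\<close> and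
  \<open>z\<close>. Each transposed term contributes as much as its partner, which gives the factor
  2, and \<open>P ** K = Q\<close> turns \<open>Q ** H\<close> into
  \<open>P ** K ** H\<close>.\<close>

lemma lmi_dissipation:
  fixes A P :: "real^'n^'n" and H :: "real^'n^'p" and Q :: "real^'p^'n"
  assumes P: "positive_definite P"
    and lmi: "negative_semidefinite
           (block_matrix
              (transpose A ** P + P ** A + transpose H ** transpose Q + Q ** H + mat \<nu>1) P
              P (- mat \<nu>2))"
    and K: "K = matrix_inv P ** Q"
  shows "2 * (v \<bullet> (P *v ((A + K ** H) *v v + z))) \<le> - \<nu>1 * (norm v)\<^sup>2 + \<nu>2 * (norm z)\<^sup>2"
proof -
  have sym: "transpose P = P" using P by (simp add: positive_definite_def)
  \<comment> \<open>A positive definite matrix has trivial kernel. Invertibility is what lets the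
    choice in \<open>matrix_inv\<close> be resolved to a genuine inverse.\<close>
  have "inj ((*v) P)"
    using P by (metis inner_zero_right less_irrefl matrix_left_invertible_injective
        matrix_left_invertible_ker positive_definite_def)
  then have "invertible P"
    by (simp add: invertible_left_inverse matrix_left_invertible_injective)
  then have PK: "P ** K = Q"
    unfolding K invertible_def matrix_inv_def matrix_mul_assoc
    by (rule someI2_ex) simp
  have mat: "mat c *v y = c *\<^sub>R y" for c and y :: "real^'n"
    by (simp add: vec_eq_iff matrix_vector_mult_def mat_def if_distrib[of "\<lambda>x. x * _"] cong: if_cong)
  have uminus_mat: "- mat c *v y = - (c *\<^sub>R y)" for c and y :: "real^'n"
    using matrix_vector_mult_diff_rdistrib[of 0 "mat c" y] by (simp add: mat)
  have PKv: "P *v (K *v y) = Q *v y" for y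
    by (simp add: matrix_vector_mul_assoc PK)
  have "v \<bullet> (transpose A *v (P *v v)) = v \<bullet> (P *v (A *v v))"
    "v \<bullet> (transpose H *v (transpose Q *v v)) = v \<bullet> (Q *v (H *v v))"
    "z \<bullet> (P *v v) = v \<bullet> (P *v z)"
    by (metis dot_matrix_vector_mult inner_commute sym transpose_transpose)+
  moreover have "v \<bullet> ((transpose A ** P + P ** A + transpose H ** transpose Q + Q ** H + mat \<nu>1) *v v + P *v z)
      + z \<bullet> (P *v v + (- mat \<nu>2) *v z) \<le> 0"
    using lmi unfolding negative_semidefinite_def
    by (subst block_matrix_quadratic_form[symmetric]) blast
  ultimately show ?thesis
    by (simp add: matrix_vector_mult_add_rdistrib matrix_vector_right_distrib mat uminus_mat PKv
        matrix_vector_mul_assoc[symmetric] inner_add inner_diff_right power2_norm_eq_inner)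
qed

section \<open>Trajectories, supremum norms and comparison functions\<close>

lemma solves_ode_subinterval:
  assumes "solves_ode f x" "0 \<le> s" "s \<le> t"
  shows "((\<lambda>r. f r (x r)) has_integral (x t - x s)) {s..t}"
  by (rule integral_equation_subinterval[of 0 t]) (use assms in \<open>auto simp: solves_ode_def\<close>)

lemma solves_ode_continuous:
  assumes "solves_ode f x" "0 \<le> a"
  shows "continuous_on {a..b} x"
  by (rule integral_equation_continuous, rule solves_ode_subinterval) (use assms in auto)

lemma infnorm_le_sup_norm:
  assumes "bounded (z ` {a..b})" "s \<in> {a..b}"
  shows "infnorm (z s) \<le> sup_norm z a b"
  unfolding sup_norm_def
proof (rule cSUP_upper[OF assms(2)])
  from assms(1) obtain c where "\<And>s. s \<in> {a..b} \<Longrightarrow> norm (z s) \<le> c"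
    unfolding bounded_iff by blast
  then show "bdd_above ((\<lambda>s. infnorm (z s)) ` {a..b})"
    by (intro bdd_aboveI2[of _ _ c] order_trans[OF infnorm_le_norm])
qed

text \<open>Bridges the two norms: the Lyapunov estimate is Euclidean, while inputs and errors are
  measured by the maximum norm. The price is the square root of the dimension.\<close>

lemma matrix_norm_bound_infnorm:
  fixes M :: "real^'a^'b"
  obtains c where "c > 0" "\<And>v. norm (M *v v) \<le> c * infnorm v"
proof -
  obtain c where c: "c > 0" "\<And>v. norm (M *v v) \<le> c * norm v"
    using matrix_norm_bound[of M] by blast
  show ?thesis
  proof
    show "c * sqrt DIM(real^'a) > 0" using c by simp
    show "norm (M *v v) \<le> c * sqrt DIM(real^'a) * infnorm v" for v
      using order_trans[OF c(2)[of v] mult_left_mono[OF norm_le_infnorm[of v], of c]] c(1)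
      by (simp only: mult.assoc)
  qed
qed

lemma class_K_linear: "c > 0 \<Longrightarrow> class_K (\<lambda>r. c * r)"
  unfolding class_K_def by (auto intro!: continuous_intros strict_mono_onI)

lemma class_KL_exponential:
  assumes "c > 0" "\<mu> > 0"
  shows "class_KL (\<lambda>r s. c * r * exp (- \<mu> * s))"
proof -
  have "class_K (\<lambda>r. c * r * exp (- \<mu> * s))" for s
    using class_K_linear[of "c * exp (- \<mu> * s)"] assms by (simp add: mult_ac)
  moreover have "((\<lambda>s. exp (- \<mu> * s)) \<longlongrightarrow> 0) at_top"
    using filterlim_tendsto_neg_mult_at_bot[OF tendsto_const[of "- \<mu>"] _ filterlim_ident] assms
    by (intro filterlim_compose[OF exp_at_bot]) simp
  then have "((\<lambda>s. c * r * exp (- \<mu> * s)) \<longlongrightarrow> 0) at_top" for r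
    by (rule tendsto_mult_right_zero)
  moreover have "antimono_on {0..} (\<lambda>s. c * r * exp (- \<mu> * s))" if "r \<ge> 0" for r
    using that assms by (auto intro!: monotone_onI mult_left_mono)
  moreover have "continuous_on ({0..} \<times> {0..}) (\<lambda>(r, s). c * r * exp (- \<mu> * s))"
    by (auto simp: case_prod_unfold intro!: continuous_intros)
  ultimately show ?thesis by (simp add: class_KL_def)
qed

section \<open>The reconstruction error on a sampling interval\<close>

theorem theorem1:
  fixes A :: "real^'n^'n" and B :: "real^'m^'n" and E :: "real^'o^'n" and H :: "real^'n^'p"
    and P :: "real^'n^'n" and Q :: "real^'p^'n" and K :: "real^'p^'n"
    and \<nu>1 \<nu>2 T :: real and N :: nat
  assumes "observable_pair A H"
    and "positive_definite P" and "\<nu>1 > 0" and "\<nu>2 > 0"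
    and "negative_semidefinite
           (block_matrix
              (transpose A ** P + P ** A + transpose H ** transpose Q + Q ** H + mat \<nu>1) P
              P (- mat \<nu>2))"
    and "K = matrix_inv P ** Q"
    and "T > 0" and "N > 0"
  shows "\<exists>\<beta> \<gamma>. class_KL \<beta> \<and> class_K \<gamma> \<and>
    (\<forall>(xc :: real^'n) (xb :: real) (ub :: real) (db :: real)
      (u :: real \<Rightarrow> real^'m) (d :: real \<Rightarrow> real^'o)
      (x :: real \<Rightarrow> real^'n) (xhat :: real \<Rightarrow> real^'n) (xr :: real \<Rightarrow> real^'n)
      (C :: nat \<Rightarrow> real^'n) (L :: nat \<Rightarrow> real^'n) (Pd :: nat \<Rightarrow> real^'n).
      xb \<ge> 0 \<and> ub \<ge> 0 \<and> db \<ge> 0 \<and>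
      locally_bounded u \<and> locally_bounded d \<and>
      x 0 \<in> hypercube xc xb \<and>
      (\<forall>t\<ge>0. B *v u t \<in> hypercube 0 ub \<and> E *v d t \<in> hypercube 0 db) \<and>
      solves_ode (\<lambda>t z. A *v z + B *v u t + E *v d t) x \<and>
      xhat 0 = xc \<and>
      solves_ode (\<lambda>t z. A *v z + B *v u t + K *v (H *v z - H *v x t)) xhat \<and>
      C 0 = xc \<and> L 0 = vec xb \<and> (\<forall>k i. L k $ i \<ge> 0) \<and>
      (\<forall>k. \<forall>t\<in>{real k * T..<real (Suc k) * T}. xhat t \<in> hyperrectangle (C (Suc k)) (L (Suc k))) \<and>
      Pd = decoded_state N T xc C L xhat \<and>
      (\<forall>k. xr (real k * T) = Pd k \<and>
        (\<forall>t\<in>{real k * T..<real (Suc k) * T}.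
          (xr has_vector_derivative A *v xr t + K *v (H *v xr t - H *v Pd k))
            (at t within {real k * T..<real (Suc k) * T})))
      \<longrightarrow>
      (\<forall>k. \<forall>t\<in>{real k * T..<real (Suc k) * T}.
        infnorm (x t - xr t) \<le>
          \<beta> (infnorm (x (real k * T) - xr (real k * T))) (t - real k * T) +
          \<gamma> (Max {sup_norm u (real k * T) t, sup_norm d (real k * T) t,
                  sup_norm (\<lambda>s. x s - xhat s) (real k * T) t,
                  sup_norm (\<lambda>s. xhat s - Pd k) (real k * T) t})))"
proof -
  obtain c1 c2 \<mu> where pos: "c1 > 0" "c2 > 0" "\<mu> > 0" and
    bound: "\<And>a b e w W. \<lbrakk>a \<le> b;
       \<And>t. t \<in> {a..b} \<Longrightarrow> ((\<lambda>s. (A + K ** H) *v e s + w s) has_integral (e t - e a)) {a..t};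
       \<And>s. s \<in> {a..b} \<Longrightarrow> norm (w s) \<le> W\<rbrakk>
       \<Longrightarrow> norm (e b) \<le> c1 * norm (e a) * exp (- \<mu> * (b - a)) + c2 * W"
    by (rule lyapunov_input_bound[OF assms(2-4) lmi_dissipation[OF assms(2,5,6)]]) blast
  obtain cB where cB: "cB > 0" "\<And>v. norm (B *v v) \<le> cB * infnorm v"
    using matrix_norm_bound_infnorm[of B] by blast
  obtain cE where cE: "cE > 0" "\<And>v. norm (E *v v) \<le> cE * infnorm v"
    using matrix_norm_bound_infnorm[of E] by blast
  obtain cK where cK: "cK > 0" "\<And>v. norm ((K ** H) *v v) \<le> cK * infnorm v"
    using matrix_norm_bound_infnorm[of "K ** H"] by blast
  define n where "n = sqrt DIM(real^'n)"
  have "n > 0" by (simp add: n_def)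
  \<comment> \<open>One constant for each term of the input \<open>w\<close> below;
    \<open>cK\<close> counts twice, for the observer error and for the quantization error.\<close>
  define G where "G = cB + cE + 2 * cK"
  have "G > 0" using cB cE cK by (simp add: G_def)
  \<comment> \<open>The estimate on a single interval, with \<open>a\<close> for the sampling time
    and \<open>q\<close> for the decoded state. All constants are already fixed.\<close>
  have main: "infnorm (x t - xr t) \<le>
      c1 * n * infnorm (x a - xr a) * exp (- \<mu> * (t - a)) +
      c2 * G * Max {sup_norm u a t, sup_norm d a t,
                    sup_norm (\<lambda>s. x s - xhat s) a t, sup_norm (\<lambda>s. xhat s - q) a t}"
    if u: "locally_bounded u" and d: "locally_bounded d"
      and x: "solves_ode (\<lambda>t z. A *v z + B *v u t + E *v d t) x"
      and xhat: "solves_ode (\<lambda>t z. A *v z + B *v u t + K *v (H *v z - H *v x t)) xhat"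
      and t: "0 \<le> a" "a \<le> t"
      and xr: "\<And>s. s \<in> {a..t} \<Longrightarrow>
        (xr has_vector_derivative A *v xr s + K *v (H *v xr s - H *v q)) (at s within {a..t})"
    for u :: "real \<Rightarrow> real^'m" and d :: "real \<Rightarrow> real^'o" and x xhat xr :: "real \<Rightarrow> real^'n"
      and a t :: real and q :: "real^'n"
  proof -
    define M where "M = Max {sup_norm u a t, sup_norm d a t,
        sup_norm (\<lambda>s. x s - xhat s) a t, sup_norm (\<lambda>s. xhat s - q) a t}"
    \<comment> \<open>Writing \<open>xr - q\<close> as
      \<open>- (x - xr) + (x - xhat) + (xhat - q)\<close> in the correction term of the
      reconstructor moves \<open>K ** H\<close> into the error dynamics and leaves \<open>w\<close>
      as the input.\<close>
    define w where "w s = B *v u s + E *v d s - (K ** H) *v (x s - xhat s) - (K ** H) *v (xhat s - q)" for s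
    have bdd: "bounded (u ` {a..t})" "bounded (d ` {a..t})"
      using u d t unfolding locally_bounded_def
      by (meson atLeastatMost_subset_iff bounded_subset image_mono order_refl order_trans)+
    have cont: "continuous_on {a..t} x" "continuous_on {a..t} xhat"
      using x xhat t solves_ode_continuous by blast+
    \<comment> \<open>The two error signals are continuous on a compact interval, so their suprema
      are genuine; for \<open>u\<close> and \<open>d\<close> this rests on local
      boundedness.\<close>
    then have bdd': "bounded ((\<lambda>s. x s - xhat s) ` {a..t})" "bounded ((\<lambda>s. xhat s - q) ` {a..t})"
      by (intro compact_imp_bounded compact_continuous_image continuous_intros; simp)+
    have w: "norm (w s) \<le> G * M" if s: "s \<in> {a..t}" for s
    proof -
      have "infnorm (u s) \<le> M" "infnorm (d s) \<le> M" "infnorm (x s - xhat s) \<le> M" "infnorm (xhat s - q) \<le> M"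
        using infnorm_le_sup_norm[OF bdd(1) s] infnorm_le_sup_norm[OF bdd(2) s]
          infnorm_le_sup_norm[OF bdd'(1) s] infnorm_le_sup_norm[OF bdd'(2) s]
        by (auto simp: M_def)
      then have "norm (B *v u s) \<le> cB * M" "norm (E *v d s) \<le> cE * M"
        "norm ((K ** H) *v (x s - xhat s)) \<le> cK * M" "norm ((K ** H) *v (xhat s - q)) \<le> cK * M"
        using cB cE cK by (meson mult_left_mono order_trans less_imp_le)+
      moreover have "norm (w s) \<le> norm (B *v u s) + norm (E *v d s)
          + norm ((K ** H) *v (x s - xhat s)) + norm ((K ** H) *v (xhat s - q))"
        unfolding w_def by (intro norm_triangle_le_diff norm_triangle_le order_refl add_mono)
      ultimately show ?thesis by (simp add: G_def algebra_simps)
    qed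
    have int: "((\<lambda>s. (A + K ** H) *v (x s - xr s) + w s) has_integral
        (x r - xr r) - (x a - xr a)) {a..r}" if r: "r \<in> {a..t}" for r
    proof -
      \<comment> \<open>The reconstructor equation holds with derivatives, the plant equation only
        in integral form; integrating the former lets the two be subtracted.\<close>
      have "((\<lambda>s. A *v xr s + K *v (H *v xr s - H *v q)) has_integral (xr r - xr a)) {a..r}"
        using r by (intro fundamental_theorem_of_calculus has_vector_derivative_within_subset[OF xr]) auto
      with solves_ode_subinterval[OF x, of a r] r t
      have "((\<lambda>s. (A *v x s + B *v u s + E *v d s) - (A *v xr s + K *v (H *v xr s - H *v q)))
          has_integral (x r - x a) - (xr r - xr a)) {a..r}"
        by (intro has_integral_diff) auto
      then show ?thesis
        by (simp add: w_def matrix_vector_mult_diff_distrib matrix_vector_mult_add_rdistrib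
            matrix_vector_mul_assoc[symmetric] algebra_simps)
    qed
    have "infnorm (x t - xr t) \<le> norm (x t - xr t)" by (rule infnorm_le_norm)
    also have "\<dots> \<le> c1 * norm (x a - xr a) * exp (- \<mu> * (t - a)) + c2 * (G * M)"
      using bound[of a t "\<lambda>s. x s - xr s" w "G * M"] t(2) int w by blast
    \<comment> \<open>Only the initial error has to be converted back to the maximum norm, at the
      cost of the factor \<open>n\<close>.\<close>
    also have "\<dots> \<le> c1 * (n * infnorm (x a - xr a)) * exp (- \<mu> * (t - a)) + c2 * (G * M)"
      unfolding n_def using pos
      by (intro add_right_mono mult_right_mono mult_left_mono norm_le_infnorm) auto
    finally show ?thesis unfolding M_def by (simp add: mult.assoc)
  qed
  show ?thesis
  proof (intro exI[of _ "\<lambda>r s. c1 * n * r * exp (- \<mu> * s)"] exI[of _ "\<lambda>r. c2 * G * r"] conjI allI impI ballI)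
    show "class_KL (\<lambda>r s. c1 * n * r * exp (- \<mu> * s))"
      using pos \<open>n > 0\<close> by (intro class_KL_exponential) auto
    show "class_K (\<lambda>r. c2 * G * r)"
      using pos \<open>G > 0\<close> by (intro class_K_linear) auto
  next
    fix xc xb ub db u d x xhat xr C L Pd k t
    assume hyps: "xb \<ge> 0 \<and> ub \<ge> 0 \<and> db \<ge> 0 \<and>
      locally_bounded u \<and> locally_bounded d \<and>
      x 0 \<in> hypercube xc xb \<and>
      (\<forall>t\<ge>0. B *v u t \<in> hypercube 0 ub \<and> E *v d t \<in> hypercube 0 db) \<and>
      solves_ode (\<lambda>t z. A *v z + B *v u t + E *v d t) x \<and>
      xhat 0 = xc \<and>
      solves_ode (\<lambda>t z. A *v z + B *v u t + K *v (H *v z - H *v x t)) xhat \<and>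
      C 0 = xc \<and> L 0 = vec xb \<and> (\<forall>k i. L k $ i \<ge> 0) \<and>
      (\<forall>k. \<forall>t\<in>{real k * T..<real (Suc k) * T}. xhat t \<in> hyperrectangle (C (Suc k)) (L (Suc k))) \<and>
      Pd = decoded_state N T xc C L xhat \<and>
      (\<forall>k. xr (real k * T) = Pd k \<and>
        (\<forall>t\<in>{real k * T..<real (Suc k) * T}.
          (xr has_vector_derivative A *v xr t + K *v (H *v xr t - H *v Pd k))
            (at t within {real k * T..<real (Suc k) * T})))"
      and t: "t \<in> {real k * T..<real (Suc k) * T}"
    show "infnorm (x t - xr t) \<le>
          c1 * n * infnorm (x (real k * T) - xr (real k * T)) * exp (- \<mu> * (t - real k * T)) +
          c2 * G * Max {sup_norm u (real k * T) t, sup_norm d (real k * T) t,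
                  sup_norm (\<lambda>s. x s - xhat s) (real k * T) t,
                  sup_norm (\<lambda>s. xhat s - Pd k) (real k * T) t}"
    proof (rule main)
      have xr: "\<forall>s\<in>{real k * T..<real (Suc k) * T}.
          (xr has_vector_derivative A *v xr s + K *v (H *v xr s - H *v Pd k))
            (at s within {real k * T..<real (Suc k) * T})"
        using hyps by blast
      show "(xr has_vector_derivative A *v xr s + K *v (H *v xr s - H *v Pd k)) (at s within {real k * T..t})"
        if s: "s \<in> {real k * T..t}" for s
      proof (rule has_vector_derivative_within_subset)
        \<comment> \<open>Since \<open>t\<close> lies strictly before the next sampling time, the
          closed interval avoids the jump of \<open>xr\<close> there.\<close>
        show "{real k * T..t} \<subseteq> {real k * T..<real (Suc k) * T}" using t by auto
        then show "(xr has_vector_derivative A *v xr s + K *v (H *v xr s - H *v Pd k))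
            (at s within {real k * T..<real (Suc k) * T})"
          using s xr by blast
      qed
    qed (use hyps t \<open>T > 0\<close> in auto)
  qed
qed

end
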